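(* Let $p$ be an odd prime and let $G$ be a finite $p$-group. If $G$ is not powerful, then there exists a normal subgroup $N$ of $G$ such that either $G/N$ is an extra-special group of exponent $p$, or $G/N = U\times V$ where $U\le Z(G/N)$ is elementary abelian and $V$ is an extra-special group of exponent $p$.
   Context: For an odd prime $p$, a finite $p$-group $G$ is powerful if $\gamma_2(G)=[G,G]\le G^p$, where $G^p$ is the subgroup generated by all $p$-th powers of elements of $G$. A finite $p$-group $E$ is extra-special if $Z(E)=\gamma_2(E)=\Phi(E)$ has order $p$, where $\Phi(E)$ is the Frattini subgroup. $Z(\cdot)$ denotes the center. *)

theory Defs
  imports "HOL-Algebra.Algebra" "HOL-Computational_Algebra.Primes"
begin

definition finite_p_group :: "nat \<Rightarrow> ('a, 'b) monoid_scheme \<Rightarrow> bool" where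
  "finite_p_group p G \<longleftrightarrow> group G \<and> finite (carrier G) \<and> (\<exists>n. order G = p ^ n)"

definition center :: "('a, 'b) monoid_scheme \<Rightarrow> 'a set" where
  "center G = {z \<in> carrier G. \<forall>x \<in> carrier G. z \<otimes>\<^bsub>G\<^esub> x = x \<otimes>\<^bsub>G\<^esub> z}"

abbreviation commutator_subgroup :: "('a, 'b) monoid_scheme \<Rightarrow> 'a set" where
  "commutator_subgroup G \<equiv> derived G (carrier G)"

definition power_subgroup :: "nat \<Rightarrow> ('a, 'b) monoid_scheme \<Rightarrow> 'a set" where
  "power_subgroup n G = generate G {x [^]\<^bsub>G\<^esub> n | x. x \<in> carrier G}"

text \<open>Powerfulness in the form used for odd primes (for \<open>p = 2\<close> one would ask for
  fourth powers instead).\<close>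

definition powerful :: "nat \<Rightarrow> ('a, 'b) monoid_scheme \<Rightarrow> bool" where
  "powerful p G \<longleftrightarrow> commutator_subgroup G \<subseteq> power_subgroup p G"

definition maximal_subgroup :: "'a set \<Rightarrow> ('a, 'b) monoid_scheme \<Rightarrow> bool" where
  "maximal_subgroup M G \<longleftrightarrow> subgroup M G \<and> M \<noteq> carrier G \<and>
     (\<forall>K. subgroup K G \<and> M \<subseteq> K \<longrightarrow> K = M \<or> K = carrier G)"

text \<open>Intersecting with the carrier makes this the whole group when there are no maximal
  subgroups.\<close>

definition frattini :: "('a, 'b) monoid_scheme \<Rightarrow> 'a set" where
  "frattini G = carrier G \<inter> \<Inter>{M. maximal_subgroup M G}"

definition extra_special :: "nat \<Rightarrow> ('a, 'b) monoid_scheme \<Rightarrow> bool" where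
  "extra_special p E \<longleftrightarrow> finite_p_group p E \<and>
     center E = commutator_subgroup E \<and> commutator_subgroup E = frattini E \<and>
     card (center E) = p"

text \<open>The value is \<open>0\<close> if there is no positive exponent.\<close>

definition exponent_of :: "('a, 'b) monoid_scheme \<Rightarrow> nat" where
  "exponent_of G = Lcm (group.ord G ` carrier G)"

text \<open>The trivial group counts as elementary abelian.\<close>

definition elementary_abelian :: "nat \<Rightarrow> ('a, 'b) monoid_scheme \<Rightarrow> bool" where
  "elementary_abelian p G \<longleftrightarrow> comm_group G \<and> (\<forall>x \<in> carrier G. x [^]\<^bsub>G\<^esub> p = \<one>\<^bsub>G\<^esub>)"

definition internal_direct_product :: "('a, 'b) monoid_scheme \<Rightarrow> 'a set \<Rightarrow> 'a set \<Rightarrow> bool" where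
  "internal_direct_product G U V \<longleftrightarrow> U \<lhd> G \<and> V \<lhd> G \<and>
     U <#>\<^bsub>G\<^esub> V = carrier G \<and> U \<inter> V = {\<one>\<^bsub>G\<^esub>}"

end

theory Submission
  imports Defs "HOL-Number_Theory.Cong"
begin

text \<open>
  Among the normal subgroups of \<open>G\<close> that contain \<open>G\<^sup>p\<close> but not \<open>[G, G]\<close> -- the
  failure of powerfulness says that \<open>G\<^sup>p\<close> itself is one -- choose a maximal one, \<open>N\<close>. The quotient
  \<open>H = G/N\<close> has exponent \<open>p\<close>, is not abelian, and by maximality of \<open>N\<close> every nontrivial normal
  subgroup of \<open>H\<close> contains \<open>[H, H]\<close>. Such an \<open>H\<close> is extra-special, so \<open>N\<close> realises the first
  alternative of the theorem.

  Indeed, \<open>Z(H)\<close> is nontrivial because \<open>H\<close> is a \<open>p\<close>-group, and every subgroup of \<open>Z(H)\<close> is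
  normal in \<open>H\<close>; hence \<open>[H, H]\<close> lies in \<open>Z(H)\<close> and in each \<open>\<langle>x\<rangle>\<close> with \<open>1 \<noteq> x \<in> Z(H)\<close>. These cyclic
  groups have prime order \<open>p\<close>, so each of them equals \<open>[H, H]\<close>, which gives \<open>Z(H) = [H, H]\<close> of order \<open>p\<close>
  (\<open>center_eq_commutator_subgroup\<close>). The Frattini subgroup contains \<open>[H, H]\<close> as soon as \<open>[H, H]\<close>
  is central (\<open>commutator_subgroup_le_frattini\<close>), and it is contained in \<open>[H, H]\<close> because \<open>H/[H, H]\<close> is a vector space over the field with \<open>p\<close>
  elements, in which hyperplanes separate every nonzero vector from \<open>0\<close>
  (\<open>exponent_p_frattini_le_commutator_subgroup\<close>).
\<close>

section \<open>Central and normal subgroups\<close>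

lemma (in group) center_subset: "center G \<subseteq> carrier G"
  by (auto simp: center_def)

lemma (in group) subgroup_center: "subgroup (center G) G"
proof (rule subgroupI)
  show "center G \<subseteq> carrier G" by (rule center_subset)
  show "center G \<noteq> {}" by (auto simp: center_def intro!: exI[of _ \<one>])
next
  fix a assume a: "a \<in> center G"
  show "inv a \<in> center G"
    unfolding center_def
  proof (intro CollectI conjI ballI)
    show "inv a \<in> carrier G" using a by (simp add: center_def)
    fix x assume x: "x \<in> carrier G"
    with a have "a \<otimes> inv x = inv x \<otimes> a" "a \<in> carrier G" by (auto simp: center_def)
    with x show "inv a \<otimes> x = x \<otimes> inv a"
      by (metis inv_closed inv_inv inv_mult_group)
  qed
next
  fix a b assume a: "a \<in> center G" and b: "b \<in> center G"
  show "a \<otimes> b \<in> center G"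
    unfolding center_def
  proof (intro CollectI conjI ballI)
    have c: "a \<in> carrier G" "b \<in> carrier G" using a b center_subset by blast+
    then show "a \<otimes> b \<in> carrier G" by simp
    fix x assume x: "x \<in> carrier G"
    have "a \<otimes> b \<otimes> x = a \<otimes> (x \<otimes> b)" using b c x by (simp add: center_def m_assoc)
    also have "\<dots> = x \<otimes> a \<otimes> b" using a c x by (simp add: center_def flip: m_assoc)
    finally show "a \<otimes> b \<otimes> x = x \<otimes> (a \<otimes> b)" using c x by (simp add: m_assoc)
  qed
qed

lemma (in group) central_subgroup_normal:
  assumes "subgroup A G" "A \<subseteq> center G"
  shows "A \<lhd> G"
  unfolding normal_inv_iff
proof (intro conjI ballI assms(1))
  fix x h assume x: "x \<in> carrier G" and h: "h \<in> A"
  with assms(2) have hc: "h \<in> carrier G" "x \<otimes> h = h \<otimes> x" by (auto simp: center_def)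
  then have "x \<otimes> h \<otimes> inv x = h" using x by (simp add: m_assoc)
  with h show "x \<otimes> h \<otimes> inv x \<in> A" by simp
qed

lemma (in group) commutator_in_commutator_subgroup:
  assumes "x \<in> carrier G" "y \<in> carrier G"
  shows "x \<otimes> y \<otimes> inv x \<otimes> inv y \<in> commutator_subgroup G"
  unfolding derived_def by (rule generate.incl) (use assms in blast)

lemma (in group) subgroup_above_commutators_normal:
  assumes M: "subgroup M G" and "commutator_subgroup G \<subseteq> M"
  shows "M \<lhd> G"
  unfolding normal_inv_iff
proof (intro conjI ballI M)
  fix x h assume x: "x \<in> carrier G" and h: "h \<in> M"
  have hc: "h \<in> carrier G" using M h by (rule subgroup.mem_carrier)
  have "x \<otimes> h \<otimes> inv x \<otimes> inv h \<otimes> h \<in> M"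
    using commutator_in_commutator_subgroup[OF x hc] assms h by (blast intro: subgroup.m_closed)
  then show "x \<otimes> h \<otimes> inv x \<in> M" using x hc by (simp add: m_assoc)
qed

lemma (in group) power_subgroup_normal: "power_subgroup n G \<lhd> G"
  unfolding power_subgroup_def
proof (rule normal_generateI)
  show "{x [^] n |x. x \<in> carrier G} \<subseteq> carrier G" by auto
  fix h g assume "h \<in> {x [^] n |x. x \<in> carrier G}" and g: "g \<in> carrier G"
  then obtain x where x: "x \<in> carrier G" "h = x [^] n" by blast
  have "(g \<otimes> x \<otimes> inv g) [^] n = g \<otimes> x [^] n \<otimes> inv g"
  proof (induction n)
    case 0
    show ?case using g by simp
  next
    case (Suc n)
    have "g \<otimes> x [^] n \<otimes> inv g \<otimes> (g \<otimes> x \<otimes> inv g) = g \<otimes> x [^] n \<otimes> (inv g \<otimes> g) \<otimes> x \<otimes> inv g"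
      using g x(1) by (simp only: m_assoc inv_closed nat_pow_closed m_closed)
    with Suc show ?case using g x(1) by (simp add: m_assoc)
  qed
  then show "g \<otimes> h \<otimes> inv g \<in> {x [^] n |x. x \<in> carrier G}"
    using g x by (auto intro!: exI[of _ "g \<otimes> x \<otimes> inv g"])
qed

lemma (in group_hom) normal_vimage:
  assumes A: "A \<lhd> H"
  shows "{x \<in> carrier G. h x \<in> A} \<lhd> G"
proof -
  interpret A: normal A H by (rule A)
  show ?thesis
    unfolding G.normal_inv_iff
  proof (intro conjI ballI)
    show "subgroup {x \<in> carrier G. h x \<in> A} G"
      by (rule G.subgroupI) (auto intro!: exI[of _ "\<one>\<^bsub>G\<^esub>"])
  qed (auto simp: A.inv_op_closed2)
qed

section \<open>The centre of a finite p-group\<close>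

text \<open>The orbits that are not singletons have length a power of \<open>p\<close> other than \<open>1\<close>, and they
  partition the points that are not fixed.\<close>

lemma (in group_action) p_group_dvd_card_moved:
  fixes p :: nat
  assumes p: "Factorial_Ring.prime p" and ord: "order G = p ^ n" and E: "finite E"
  shows "p dvd card {x \<in> E. \<exists>g \<in> carrier G. \<phi> g x \<noteq> x}"
proof -
  interpret G: group G using group_hom group_hom.axioms(1) by auto
  define C where "C = {orb \<in> orbits G E \<phi>. card orb \<noteq> 1}"
  have orbit_sub: "orbit G \<phi> x \<subseteq> E" if "x \<in> E" for x
    using that element_image by (auto simp: orbit_def)
  have fixed_iff: "card (orbit G \<phi> x) \<noteq> 1 \<longleftrightarrow> (\<exists>g \<in> carrier G. \<phi> g x \<noteq> x)" if x: "x \<in> E" for x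
  proof
    assume "card (orbit G \<phi> x) \<noteq> 1"
    moreover have "orbit G \<phi> x = {x}" if "\<forall>g \<in> carrier G. \<phi> g x = x"
      using that by (force simp: orbit_def)
    ultimately show "\<exists>g \<in> carrier G. \<phi> g x \<noteq> x" by fastforce
  next
    assume "\<exists>g \<in> carrier G. \<phi> g x \<noteq> x"
    then obtain y where "y \<in> orbit G \<phi> x" "y \<noteq> x" by (auto simp: orbit_def)
    with orbit_refl[OF x] show "card (orbit G \<phi> x) \<noteq> 1"
      by (metis card_1_singletonE singletonD)
  qed
  have "{x \<in> E. \<exists>g \<in> carrier G. \<phi> g x \<noteq> x} = \<Union>C"
  proof (intro equalityI subsetI)
    fix x assume "x \<in> {x \<in> E. \<exists>g \<in> carrier G. \<phi> g x \<noteq> x}"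
    then have "x \<in> E" "card (orbit G \<phi> x) \<noteq> 1" using fixed_iff by auto
    then show "x \<in> \<Union>C" using orbit_refl by (auto simp: C_def orbits_def)
  next
    fix y assume "y \<in> \<Union>C"
    then obtain x where x: "x \<in> E" "y \<in> orbit G \<phi> x" "card (orbit G \<phi> x) \<noteq> 1"
      by (auto simp: C_def orbits_def)
    then have y: "y \<in> E" using orbit_sub by blast
    have "orbit G \<phi> y = orbit G \<phi> x"
      using disjoint_union[of "orbit G \<phi> y" "orbit G \<phi> x"] x y orbit_refl[OF y]
      by (auto simp: orbits_def)
    with x y fixed_iff[OF y] show "y \<in> {x \<in> E. \<exists>g \<in> carrier G. \<phi> g x \<noteq> x}" by simp
  qed
  moreover have "p dvd card (\<Union>C)"
  proof (rule dvd_partition)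
    have "\<Union>C \<subseteq> E" using orbit_sub by (auto simp: C_def orbits_def)
    then show "finite (\<Union>C)" using E finite_subset by blast
    show "\<forall>c\<in>C. p dvd card c"
    proof
      fix c assume "c \<in> C"
      then obtain x where x: "x \<in> E" and c: "c = orbit G \<phi> x" "card c \<noteq> 1"
        by (auto simp: C_def orbits_def)
      have "card c dvd p ^ n"
        using orbit_stabilizer_theorem[OF x] ord c(1) by (metis dvd_triv_left)
      then obtain i where "card c = p ^ i" using divides_primepow_nat[OF p] by blast
      with c(2) show "p dvd card c" by (cases i) auto
    qed
    show "\<forall>c1\<in>C. \<forall>c2\<in>C. c1 \<noteq> c2 \<longrightarrow> c1 \<inter> c2 = {}"
      using disjoint_union by (auto simp: C_def)
  qed
  ultimately show ?thesis by simp
qed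

text \<open>The noncentral elements are the points moved by conjugation, so their number is divisible by
  \<open>p\<close>; a trivial centre would leave \<open>p\<^sup>n - 1\<close> of them.\<close>

lemma (in group) p_group_center_nontrivial:
  fixes p :: nat
  assumes p: "Factorial_Ring.prime p" and pG: "finite_p_group p G" and nt: "carrier G \<noteq> {\<one>}"
  shows "center G \<noteq> {\<one>}"
proof
  assume triv: "center G = {\<one>}"
  obtain n where fin: "finite (carrier G)" and n: "order G = p ^ n"
    using pG by (auto simp: finite_p_group_def)
  have conj_fixed: "g \<otimes> x \<otimes> inv g = x \<longleftrightarrow> x \<otimes> g = g \<otimes> x" if "x \<in> carrier G" "g \<in> carrier G" for x g
    using that by (metis inv_solve_right m_closed)
  have "{x \<in> carrier G. \<exists>g \<in> carrier G. (\<lambda>h \<in> carrier G. g \<otimes> h \<otimes> inv g) x \<noteq> x}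
      = carrier G - center G"
    using conj_fixed by (auto simp: center_def)
  with group_action.p_group_dvd_card_moved[OF action_by_conjugation p n fin]
  have "p dvd card (carrier G - {\<one>})" using triv by simp
  then have "p dvd p ^ n - 1" using n fin by (simp add: order_def)
  moreover have "n \<noteq> 0"
  proof
    assume "n = 0"
    then have "card (carrier G) = 1" using n by (simp add: order_def)
    then show False using nt by (metis card_1_singletonE one_closed singletonD)
  qed
  then have "p dvd p ^ n" by simp
  moreover have "p ^ n \<ge> 1" using p by (simp add: prime_gt_0_nat Suc_leI)
  ultimately have "p dvd 1" by (metis dvd_diffD1)
  then show False using p by (simp add: prime_nat_iff)
qed

section \<open>The Frattini subgroup\<close>

text \<open>A maximal subgroup \<open>M\<close> either contains the centre, and with it \<open>[G, G]\<close>, or satisfies \<open>Z(G) M = G\<close>.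
  In the second case central factors cancel in commutators, so every commutator of \<open>G\<close> is one of
  elements of \<open>M\<close>.\<close>

lemma (in group) commutator_subgroup_le_frattini:
  assumes central: "commutator_subgroup G \<subseteq> center G"
  shows "commutator_subgroup G \<subseteq> frattini G"
proof -
  have "commutator_subgroup G \<subseteq> M" if max: "maximal_subgroup M G" for M
  proof (cases "center G \<subseteq> M")
    case True
    with central show ?thesis by blast
  next
    case False
    have M: "subgroup M G" using max by (simp add: maximal_subgroup_def)
    have Z: "center G \<lhd> G" using central_subgroup_normal subgroup_center by blast
    have sub: "subgroup (center G <#> M) G" using mult_norm_subgroup[OF Z M] .
    have "M \<subseteq> center G <#> M"
    proof
      fix m assume "m \<in> M"
      moreover then have "\<one> \<otimes> m = m" using M by (simp add: subgroup.mem_carrier)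
      ultimately show "m \<in> center G <#> M"
        using subgroup.one_closed[OF subgroup_center] unfolding set_mult_def by fastforce
    qed
    moreover have "center G \<subseteq> center G <#> M"
    proof
      fix z assume "z \<in> center G"
      moreover then have "z \<otimes> \<one> = z" using center_subset by auto
      ultimately show "z \<in> center G <#> M"
        using subgroup.one_closed[OF M] unfolding set_mult_def by fastforce
    qed
    ultimately have all: "center G <#> M = carrier G"
      using max sub False unfolding maximal_subgroup_def by blast
    have "x \<otimes> y \<otimes> inv x \<otimes> inv y \<in> M" if xy: "x \<in> carrier G" "y \<in> carrier G" for x y
    proof -
      obtain z m where x: "z \<in> center G" "m \<in> M" "x = z \<otimes> m"
        using xy(1) all unfolding set_mult_def by blast
      obtain w k where y: "w \<in> center G" "k \<in> M" "y = w \<otimes> k"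
        using xy(2) all unfolding set_mult_def by blast
      have c: "z \<in> carrier G" "m \<in> carrier G" "w \<in> carrier G" "k \<in> carrier G"
        using x(1,2) y(1,2) subgroup.mem_carrier[OF M] subgroup.mem_carrier[OF subgroup_center]
        by auto
      (* 1 and 2 bring the central factors of xy and yx to the front; these cancel in the commutator *)
      have wx: "w \<otimes> x = x \<otimes> w" and zk: "z \<otimes> k = k \<otimes> z"
        using x(1) y(1) xy c by (auto simp: center_def)
      have "x \<otimes> y = w \<otimes> (x \<otimes> k)"
        using xy c y(3) wx by (metis m_assoc)
      also have "x \<otimes> k = z \<otimes> (m \<otimes> k)" using x(3) c by (simp add: m_assoc)
      finally have 1: "x \<otimes> y = w \<otimes> (z \<otimes> (m \<otimes> k))" .
      have "y \<otimes> x = w \<otimes> (k \<otimes> (z \<otimes> m))" using x(3) y(3) c by (simp add: m_assoc)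
      also have "k \<otimes> (z \<otimes> m) = z \<otimes> (k \<otimes> m)" using zk c by (metis m_assoc)
      finally have 2: "y \<otimes> x = w \<otimes> (z \<otimes> (k \<otimes> m))" .
      have "m \<otimes> k \<otimes> inv m \<otimes> inv k \<otimes> (k \<otimes> m) = m \<otimes> k"
        using c by (simp add: m_assoc inv_solve_left')
      then have "x \<otimes> y = w \<otimes> (z \<otimes> ((m \<otimes> k \<otimes> inv m \<otimes> inv k) \<otimes> (k \<otimes> m)))"
        using 1 by simp
      also have "\<dots> = (m \<otimes> k \<otimes> inv m \<otimes> inv k) \<otimes> (y \<otimes> x)"
      proof -
        let ?q = "m \<otimes> k \<otimes> inv m \<otimes> inv k"
        have q: "?q \<in> carrier G" using c by simp
        have qz: "z \<otimes> ?q = ?q \<otimes> z" and qw: "w \<otimes> ?q = ?q \<otimes> w"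
          using x(1) y(1) q by (auto simp: center_def)
        have "w \<otimes> (z \<otimes> (?q \<otimes> (k \<otimes> m))) = w \<otimes> (z \<otimes> ?q) \<otimes> (k \<otimes> m)"
          using c q by (simp only: m_assoc m_closed)
        also have "\<dots> = w \<otimes> ?q \<otimes> z \<otimes> (k \<otimes> m)"
          unfolding qz using c q by (simp only: m_assoc m_closed)
        also have "\<dots> = ?q \<otimes> (w \<otimes> (z \<otimes> (k \<otimes> m)))"
          unfolding qw using c q by (simp only: m_assoc m_closed)
        finally show ?thesis using 2 by (simp only:)
      qed
      finally have "x \<otimes> y = (m \<otimes> k \<otimes> inv m \<otimes> inv k) \<otimes> (y \<otimes> x)" .
      then have "x \<otimes> y \<otimes> inv x \<otimes> inv y = m \<otimes> k \<otimes> inv m \<otimes> inv k"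
        using xy c by (simp add: m_assoc)
      also have "\<dots> \<in> M"
        using x(2) y(2) M by (simp add: subgroup.m_closed subgroup.m_inv_closed)
      finally show ?thesis .
    qed
    then show ?thesis
      unfolding derived_def by (intro generate_subgroup_incl[OF _ M]) auto
  qed
  then show ?thesis
    using derived_in_carrier[OF subset_refl] unfolding frattini_def by blast
qed

text \<open>A subgroup that is maximal among those above the commutator subgroup and avoiding \<open>x\<close> is the preimage of a
  hyperplane of the vector space \<open>G/[G, G]\<close>, and hence a maximal subgroup.\<close>

lemma (in group) exponent_p_frattini_le_commutator_subgroup:
  fixes p :: nat
  assumes p: "Factorial_Ring.prime p" and fin: "finite (carrier G)"
    and exp: "\<And>x. x \<in> carrier G \<Longrightarrow> x [^] p = \<one>"
  shows "frattini G \<subseteq> commutator_subgroup G"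
proof (rule subsetI, rule ccontr)
  fix x assume xF: "x \<in> frattini G" and xD: "x \<notin> commutator_subgroup G"
  have x: "x \<in> carrier G" using xF by (simp add: frattini_def)
  define S where "S = {M. subgroup M G \<and> commutator_subgroup G \<subseteq> M \<and> x \<notin> M}"
  have "S \<subseteq> Pow (carrier G)" by (auto simp: S_def dest: subgroup.subset)
  then have "finite S" using fin by (simp add: finite_subset)
  moreover have "commutator_subgroup G \<in> S"
    using xD derived_is_subgroup by (simp add: S_def)
  ultimately obtain M where "M \<in> S" and Mmax: "\<And>K. K \<in> S \<Longrightarrow> M \<subseteq> K \<Longrightarrow> K = M"
    using finite_has_maximal[of S] by blast
  then have M: "subgroup M G" "commutator_subgroup G \<subseteq> M" "x \<notin> M" by (auto simp: S_def)
  have MN: "M \<lhd> G" using subgroup_above_commutators_normal M by blast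
  have "maximal_subgroup M G"
    unfolding maximal_subgroup_def
  proof (intro conjI allI impI M(1))
    show "M \<noteq> carrier G" using x M(3) by blast
    fix K assume K: "subgroup K G \<and> M \<subseteq> K"
    show "K = M \<or> K = carrier G"
    proof (cases "K = M")
      case False
      with K Mmax[of K] M have xK: "x \<in> K" by (auto simp: S_def)
      have "y \<in> K" if y: "y \<in> carrier G" for y
      proof (cases "y \<in> M")
        case True
        with K show ?thesis by blast
      next
        case yM: False
        let ?L = "M <#> generate G {y}"
        have gy: "subgroup (generate G {y}) G" using y by (intro generate_is_subgroup) auto
        have L: "subgroup ?L G" by (rule mult_norm_subgroup[OF MN gy])
        have "\<one> \<otimes> y \<in> ?L"
          unfolding set_mult_def using subgroup.one_closed[OF M(1)] generate.incl[of y "{y}" G] by blast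
        then have yL: "y \<in> ?L" using y by simp
        have M_le_L: "M \<subseteq> ?L"
        proof
          fix m assume m: "m \<in> M"
          then have "m \<otimes> \<one> \<in> ?L"
            unfolding set_mult_def using subgroup.one_closed[OF gy] by blast
          with m M(1) show "m \<in> ?L" by (simp add: subgroup.mem_carrier)
        qed
        have "x \<in> ?L"
          using Mmax[of ?L] L M_le_L M yL yM by (auto simp: S_def)
        then obtain m u where m: "m \<in> M" and "u \<in> generate G {y}" and xu: "x = m \<otimes> u"
          unfolding set_mult_def by blast
        then obtain k :: nat where u: "u = y [^] k"
          using generate_pow_on_finite_carrier[OF fin y] by blast
        have mc: "m \<in> carrier G" using m M(1) by (rule subgroup.mem_carrier[rotated])
        have uM: "u \<notin> M" using m M(1,3) xu by (auto intro: subgroup.m_closed)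
        have "\<not> p dvd k"
        proof
          assume "p dvd k"
          then obtain q where "k = p * q" ..
          then have "u = \<one>" using u y exp by (simp add: nat_pow_pow[symmetric])
          with uM M(1) show False by (simp add: subgroup.one_closed)
        qed
        then have "coprime k p" using p by (metis coprime_commute prime_imp_coprime)
        then obtain j where j: "[k * j = 1] (mod p)"
          using cong_solve_coprime_nat by auto
        (* modulo M the vectors x and y are proportional, and k is inverted modulo p *)
        have "y [^] (k * j) = y [^] (1::nat)"
        proof -
          have red: "y [^] i = y [^] (i mod p)" for i :: nat
          proof -
            have "y [^] i = y [^] (p * (i div p) + i mod p)" by (simp only: mult_div_mod_eq)
            also have "\<dots> = (y [^] p) [^] (i div p) \<otimes> y [^] (i mod p)"
              using y by (simp only: nat_pow_mult nat_pow_pow)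
            finally show ?thesis using y exp by simp
          qed
          show ?thesis using j red[of "k * j"] red[of 1] by (simp add: cong_def)
        qed
        then have "y = u [^] j" using u y by (simp add: nat_pow_pow)
        moreover have "u = inv m \<otimes> x" using xu mc y u by (simp add: inv_solve_left)
        then have "u \<in> K"
          using K m xK by (metis subgroup.m_closed subgroup.m_inv_closed subsetD)
        then have "u [^] j \<in> K" using K by (induction j) (auto simp: subgroup.one_closed subgroup.m_closed)
        ultimately show ?thesis by simp
      qed
      then show ?thesis using K subgroup.subset by blast
    qed simp
  qed
  with xF M(3) show False by (auto simp: frattini_def)
qed

section \<open>Extra-special groups from minimality of the commutator subgroup\<close>

lemma (in group) exponent_p_ord:
  fixes p :: nat
  assumes p: "Factorial_Ring.prime p" and "x [^] p = \<one>" "x \<in> carrier G" "x \<noteq> \<one>"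
  shows "ord x = p"
proof -
  have "ord x dvd p" using assms pow_eq_id by blast
  moreover have "ord x \<noteq> 1" using assms ord_eq_1 by simp
  ultimately show ?thesis using p by (metis prime_nat_iff)
qed

lemma (in group) exponent_of_eq_prime:
  fixes p :: nat
  assumes p: "Factorial_Ring.prime p" and exp: "\<And>x. x \<in> carrier G \<Longrightarrow> x [^] p = \<one>"
    and nt: "carrier G \<noteq> {\<one>}"
  shows "exponent_of G = p"
proof (rule dvd_antisym)
  show "exponent_of G dvd p"
    unfolding exponent_of_def by (rule Lcm_least) (use exp pow_eq_id in blast)
  obtain x where "x \<in> carrier G" "x \<noteq> \<one>" using nt one_closed by blast
  then show "p dvd exponent_of G"
    unfolding exponent_of_def using exponent_p_ord[OF p exp] by (intro dvd_Lcm) force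
qed

text \<open>Each subgroup generated by a nontrivial central element is normal of prime order, so minimality forces
  it to coincide with the commutator subgroup.\<close>

lemma (in group) center_eq_commutator_subgroup:
  fixes p :: nat
  assumes p: "Factorial_Ring.prime p" and pG: "finite_p_group p G"
    and exp: "\<And>x. x \<in> carrier G \<Longrightarrow> x [^] p = \<one>"
    and nonab: "commutator_subgroup G \<noteq> {\<one>}"
    and min: "\<And>A. A \<lhd> G \<Longrightarrow> A \<noteq> {\<one>} \<Longrightarrow> commutator_subgroup G \<subseteq> A"
  shows "center G = commutator_subgroup G" and "card (center G) = p"
proof -
  let ?D = "commutator_subgroup G"
  have D: "subgroup ?D G" by (rule derived_is_subgroup) simp
  have fin: "finite (carrier G)" using pG by (simp add: finite_p_group_def)
  have cyclic: "generate G {x} = ?D \<and> ord x = p" if x: "x \<in> center G" "x \<noteq> \<one>" for x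
  proof -
    have xc: "x \<in> carrier G" using x center_subset by blast
    have ord: "ord x = p" using exponent_p_ord[OF p exp[OF xc] xc x(2)] .
    have sub: "subgroup (generate G {x}) G" using xc by (intro generate_is_subgroup) auto
    have "generate G {x} \<subseteq> center G"
      using x subgroup_center by (intro generate_subgroup_incl) auto
    then have "generate G {x} \<lhd> G" using central_subgroup_normal sub by blast
    moreover have "generate G {x} \<noteq> {\<one>}" using x(2) generate.incl[of x "{x}" G] by blast
    ultimately have le: "?D \<subseteq> generate G {x}" by (rule min)
    have card: "card (generate G {x}) = p" using generate_pow_card[OF xc] ord by simp
    have "card ?D dvd card (generate G {x})"
    proof -
      interpret X: group "G\<lparr>carrier := generate G {x}\<rparr>" using sub by (rule subgroup_imp_group)
      have "subgroup ?D (G\<lparr>carrier := generate G {x}\<rparr>)" using subgroup_incl[OF D sub le] .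
      from X.lagrange[OF this] show ?thesis by (simp add: order_def) (metis dvd_triv_right)
    qed
    moreover have "card ?D \<noteq> 1"
      using nonab subgroup.one_closed[OF D] by (metis card_1_singletonE singletonD)
    ultimately have "card ?D = p" using card p by (metis prime_nat_iff)
    then have "?D = generate G {x}"
      using le card fin subgroup.subset[OF sub] by (metis card_subset_eq finite_subset)
    then show ?thesis using ord by simp
  qed
  have "carrier G \<noteq> {\<one>}"
    using nonab subgroup.subset[OF D] subgroup.one_closed[OF D] by auto
  then have "center G \<noteq> {\<one>}" by (rule p_group_center_nontrivial[OF p pG])
  then obtain z where z: "z \<in> center G" "z \<noteq> \<one>"
    using subgroup.one_closed[OF subgroup_center] by blast
  have "?D \<subseteq> center G"
    using min[OF central_subgroup_normal[OF subgroup_center subset_refl]] z by blast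
  moreover have "x \<in> ?D" if "x \<in> center G" for x
    using cyclic[OF that] generate.incl[of x "{x}" G] subgroup.one_closed[OF D] by (cases "x = \<one>") auto
  ultimately show eq: "center G = ?D" by blast
  show "card (center G) = p"
    using cyclic[OF z] eq z(1) center_subset generate_pow_card by (metis subsetD)
qed

lemma (in group) extra_specialI_minimal_commutator_subgroup:
  fixes p :: nat
  assumes p: "Factorial_Ring.prime p" and pG: "finite_p_group p G"
    and exp: "\<And>x. x \<in> carrier G \<Longrightarrow> x [^] p = \<one>"
    and nonab: "commutator_subgroup G \<noteq> {\<one>}"
    and min: "\<And>A. A \<lhd> G \<Longrightarrow> A \<noteq> {\<one>} \<Longrightarrow> commutator_subgroup G \<subseteq> A"
  shows "extra_special p G"
proof -
  note Z = center_eq_commutator_subgroup[OF p pG exp nonab min]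
  have "finite (carrier G)" using pG by (simp add: finite_p_group_def)
  then have "frattini G = commutator_subgroup G"
    using exponent_p_frattini_le_commutator_subgroup[OF p _ exp] commutator_subgroup_le_frattini Z(1)
    by blast
  then show ?thesis unfolding extra_special_def using pG Z by simp
qed

section \<open>Quotients\<close>

lemma (in normal) finite_p_group_FactGroup:
  fixes p :: nat
  assumes p: "Factorial_Ring.prime p" and pG: "finite_p_group p G"
  shows "finite_p_group p (G Mod H)"
proof -
  obtain n where fin: "finite (carrier G)" and n: "order G = p ^ n"
    using pG by (auto simp: finite_p_group_def)
  have "order (G Mod H) dvd p ^ n"
    using lagrange[OF subgroup_axioms] n by (metis FactGroup_def dvd_triv_left order_def partial_object.simps(1))
  then have "\<exists>i. order (G Mod H) = p ^ i" using divides_primepow_nat[OF p] by blast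
  then show ?thesis
    using fin factorgroup_is_group by (simp add: finite_p_group_def carrier_FactGroup)
qed

text \<open>For \<open>N\<close> maximal among the normal subgroups above \<open>G\<^sup>p\<close> that do not contain \<open>[G, G]\<close>,
  maximality of \<open>N\<close> becomes minimality of the commutator subgroup of \<open>G/N\<close>: the preimage in \<open>G\<close> of a
  nontrivial normal subgroup of \<open>G/N\<close> is strictly larger than \<open>N\<close> and therefore contains \<open>[G, G]\<close>.\<close>

lemma (in group) extra_special_exponent_p_quotient:
  fixes p :: nat
  assumes p: "Factorial_Ring.prime p" and pG: "finite_p_group p G" and np: "\<not> powerful p G"
  shows "\<exists>N. N \<lhd> G \<and> extra_special p (G Mod N) \<and> exponent_of (G Mod N) = p"
proof -
  have fin: "finite (carrier G)" using pG by (simp add: finite_p_group_def)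
  define S where "S = {N. N \<lhd> G \<and> power_subgroup p G \<subseteq> N \<and> \<not> commutator_subgroup G \<subseteq> N}"
  have "S \<subseteq> Pow (carrier G)"
    by (auto simp: S_def dest: normal_imp_subgroup subgroup.subset)
  then have "finite S" using fin by (simp add: finite_subset)
  moreover have "power_subgroup p G \<in> S"
    using np power_subgroup_normal by (simp add: S_def powerful_def)
  ultimately obtain N where "N \<in> S" and Nmax: "\<And>K. K \<in> S \<Longrightarrow> N \<subseteq> K \<Longrightarrow> K = N"
    using finite_has_maximal[of S] by blast
  then have N: "N \<lhd> G" "power_subgroup p G \<subseteq> N" "\<not> commutator_subgroup G \<subseteq> N"
    by (auto simp: S_def)
  interpret N: normal N G by (rule N(1))
  let ?H = "G Mod N" and ?\<pi> = "\<lambda>x. N #> x"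
  interpret H: group ?H by (rule N.factorgroup_is_group)
  interpret \<pi>: group_hom G ?H ?\<pi> by unfold_locales (rule N.r_coset_hom_Mod)
  have pH: "finite_p_group p ?H" by (rule N.finite_p_group_FactGroup[OF p pG])
  have in_N: "N #> x = N \<longleftrightarrow> x \<in> N" if "x \<in> carrier G" for x
    using that N.subgroup_axioms by (metis coset_join1 coset_join2 N.subset)
  have exp: "C [^]\<^bsub>?H\<^esub> p = \<one>\<^bsub>?H\<^esub>" if C: "C \<in> carrier ?H" for C
  proof -
    obtain x where x: "x \<in> carrier G" "C = N #> x" using C by (auto simp: carrier_FactGroup)
    have "x [^] p \<in> power_subgroup p G"
      unfolding power_subgroup_def by (rule generate.incl) (use x in blast)
    with x N(2) in_N[of "x [^] p"] show ?thesis by (auto simp: N.FactGroup_pow)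
  qed
  have derived_H: "commutator_subgroup ?H = ?\<pi> ` commutator_subgroup G"
    using \<pi>.derived_img[of "carrier G"] by (simp add: carrier_FactGroup)
  have nonab: "commutator_subgroup ?H \<noteq> {\<one>\<^bsub>?H\<^esub>}"
  proof
    assume triv: "commutator_subgroup ?H = {\<one>\<^bsub>?H\<^esub>}"
    have "x \<in> N" if x: "x \<in> commutator_subgroup G" for x
    proof -
      have "N #> x = N" using x triv derived_H by auto
      then show ?thesis using x in_N derived_in_carrier[OF subset_refl] by blast
    qed
    with N(3) show False by blast
  qed
  have min: "commutator_subgroup ?H \<subseteq> A" if A: "A \<lhd> ?H" "A \<noteq> {\<one>\<^bsub>?H\<^esub>}" for A
  proof -
    interpret A: normal A ?H by (rule A(1))
    let ?M = "{x \<in> carrier G. ?\<pi> x \<in> A}"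
    have M: "?M \<lhd> G" by (rule \<pi>.normal_vimage[OF A(1)])
    have NM: "N \<subseteq> ?M"
    proof
      fix x assume x: "x \<in> N"
      with in_N[of x] A.one_closed show "x \<in> ?M" by (simp add: N.mem_carrier)
    qed
    obtain C where C: "C \<in> A" "C \<noteq> \<one>\<^bsub>?H\<^esub>" using A(2) A.one_closed by blast
    then obtain x where x: "x \<in> carrier G" "C = N #> x"
      using A.mem_carrier by (auto simp: carrier_FactGroup)
    with C in_N[of x] have "x \<in> ?M" "x \<notin> N" by auto
    then have "?M \<noteq> N" by blast
    with Nmax[of ?M] NM have "?M \<notin> S" by blast
    with M NM N(2) have "commutator_subgroup G \<subseteq> ?M" unfolding S_def by blast
    then show ?thesis using derived_H by auto
  qed
  have "extra_special p ?H"
    using H.extra_specialI_minimal_commutator_subgroup[OF p pH exp nonab min] .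
  moreover have "carrier ?H \<noteq> {\<one>\<^bsub>?H\<^esub>}"
    using nonab H.derived_in_carrier[OF subset_refl] subgroup.one_closed[OF H.derived_is_subgroup[OF subset_refl]]
    by auto
  then have "exponent_of ?H = p" using H.exponent_of_eq_prime[OF p exp] by blast
  ultimately show ?thesis using N(1) by blast
qed

theorem theorem2p5:
  fixes p :: nat and G :: "('a, 'b) monoid_scheme"
  assumes "Factorial_Ring.prime p" and "odd p"
    and "finite_p_group p G"
    and "\<not> powerful p G"
  shows "\<exists>N. N \<lhd> G \<and>
    ((extra_special p (G Mod N) \<and> exponent_of (G Mod N) = p) \<or>
     (\<exists>U V. internal_direct_product (G Mod N) U V \<and>
        U \<subseteq> center (G Mod N) \<and>
        elementary_abelian p ((G Mod N)\<lparr>carrier := U\<rparr>) \<and>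
        extra_special p ((G Mod N)\<lparr>carrier := V\<rparr>) \<and>
        exponent_of ((G Mod N)\<lparr>carrier := V\<rparr>) = p))"
proof -
  interpret group G using assms(3) by (simp add: finite_p_group_def)
  show ?thesis using extra_special_exponent_p_quotient[OF assms(1,3,4)] by blast
qed

end
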